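(* Fix integers $q\ge 2$, $k\ge 3$, $l\in\{1,\dots,k-1\}$ and $r$ with $3\le r\le k$, and let $u(n)$ satisfy $u(n)\to\infty$ and $u(n)/n\to 0$. Suppose that every local function $f_a\colon[q]^k\to[q]^l$ used in the generator is surjective and $(r-1)$-wise independent. Let $\mu$ be any constant with $0<\mu<\mu_{\mathrm c}(k,r):=\binom{k}{r}^{-1}\frac{(r-2)^{r-2}}{r(r-1)^{r-1}}$, and let $m=\lfloor \mu\, n^{r-1}/u(n)^{r-2}\rfloor$. Then there is a constant $c>0$ such that for all sufficiently large $n$, with probability at least $1-e^{-c\,u(n)}$ (over the random generator and the planted input), the linear program (LP) below has a zero-optimal solution whose integral part has fewer than $\bigl(1+\frac{1}{r-2}\bigr)u(n)$ elements; i.e. the LP relaxation cannot fix $\frac{1}{r-2}u(n)$ input variables beyond the $u(n)$ known ones.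
   Context: Random generalized Goldreich generator: $[q]=\{1,\dots,q\}$. For each $a\in[m]$ a (deterministic) function $f_a\colon[q]^k\to[q]^l$ is fixed. For each $a\in[m]$ independently, a $k$-tuple $(i^{(a)}_1,\dots,i^{(a)}_k)$ of pairwise distinct elements of $[n]$ is chosen uniformly among all $n(n-1)\cdots(n-k+1)$ such tuples; write $\partial(a)=\{i^{(a)}_1,\dots,i^{(a)}_k\}$ and $\bm x^{(a)}=(x_{i^{(a)}_1},\dots,x_{i^{(a)}_k})$. A planted input $\bm x^*$ is chosen uniformly from $[q]^n$, independently, and $\bm y_a:=f_a(\bm x^{*(a)})$ for $a\in[m]$. $(r-1)$-wise independence: if $X_1,\dots,X_k$ are i.i.d. uniform on $[q]$, then for every $T\subseteq[k]$ with $|T|\le r-1$ the joint distribution of $((X_i)_{i\in T}, f(X_1,\dots,X_k))$ is uniform on $[q]^{|T|}\times[q]^l$. The LP (local marginal polytope relaxation with the first $u(n)$ variables fixed to planted values): the variables are probability distributions $b_i$ on $[q]$ for $i\in[n]$ and $b_{(a)}$ on $[q]^k$ for $a\in[m]$, subject to (i) for every $a\in[m]$ and every position $s\in[k]$, the marginal of $b_{(a)}$ on its $s$-th coordinate equals $b_{i^{(a)}_s}$; (ii) $b_i(x^*_i)=1$ for $i=1,\dots,u(n)$. The objective to minimize is $\sum_{a=1}^m\sum_{\bm x\in[q]^k} b_{(a)}(\bm x)\,\mathbb I\{f_a(\bm x)\ne\bm y_a\}$. A zero-optimal solution is a feasible point with objective value $0$ (one exists, given by the planted assignment). The integral part of a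 feasible point is $\{i\in[n]:\exists x\in[q],\ b_i(x)=1\}$. *)

theory Defs
  imports "HOL-Probability.Probability"
begin

text \<open>[q]^S represented as extensional functions S \<rightarrow> {0..<q}. The alphabet [q] and the
index set [n] are represented 0-based: {..<q}, {..<n}.\<close>
definition qcube :: "nat \<Rightarrow> nat set \<Rightarrow> (nat \<Rightarrow> nat) set" where
  "qcube q S = PiE S (\<lambda>_. {..<q})"

definition tuples :: "nat \<Rightarrow> nat \<Rightarrow> (nat \<Rightarrow> nat) set" where
  "tuples n k = {i \<in> PiE {..<k} (\<lambda>_. {..<n}). inj_on i {..<k}}"

definition surj_local :: "nat \<Rightarrow> nat \<Rightarrow> nat \<Rightarrow> ((nat \<Rightarrow> nat) \<Rightarrow> (nat \<Rightarrow> nat)) \<Rightarrow> bool" where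
  "surj_local q k l f \<longleftrightarrow> f ` qcube q {..<k} = qcube q {..<l}"

definition wise_indep :: "nat \<Rightarrow> nat \<Rightarrow> nat \<Rightarrow> nat \<Rightarrow> ((nat \<Rightarrow> nat) \<Rightarrow> (nat \<Rightarrow> nat)) \<Rightarrow> bool" where
  "wise_indep q k l r f \<longleftrightarrow>
     (\<forall>T. T \<subseteq> {..<k} \<longrightarrow> card T \<le> r - 1 \<longrightarrow>
        map_pmf (\<lambda>X. (restrict X T, f X)) (pmf_of_set (qcube q {..<k}))
          = pmf_of_set (qcube q T \<times> qcube q {..<l}))"

definition mu_c :: "nat \<Rightarrow> nat \<Rightarrow> real" where
  "mu_c k r = (1 / real (k choose r)) * ((real r - 2) ^ (r - 2) / (real r * (real r - 1) ^ (r - 1)))"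

definition gen_m :: "real \<Rightarrow> nat \<Rightarrow> (nat \<Rightarrow> nat) \<Rightarrow> nat \<Rightarrow> nat" where
  "gen_m \<mu> r u n = nat \<lfloor>\<mu> * real n ^ (r - 1) / real (u n) ^ (r - 2)\<rfloor>"

text \<open>Sample space: tuples I a (a < m) and planted input xs; uniform on the product
  = independent uniform choices.\<close>
definition sample_space :: "nat \<Rightarrow> nat \<Rightarrow> nat \<Rightarrow> nat \<Rightarrow> ((nat \<Rightarrow> nat \<Rightarrow> nat) \<times> (nat \<Rightarrow> nat)) set" where
  "sample_space q n k m = PiE {..<m} (\<lambda>_. tuples n k) \<times> qcube q {..<n}"

text \<open>Feasible point of the LP with objective value 0 (zero-optimal solution).
  bv i is the distribution b_i on [q]; bf a is the distribution b_(a) on [q]^k;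
  f a is the local function f_a; I a s is the s-th element of the tuple of a;
  xs is the planted input; the first u variables (indices < u) are fixed.\<close>
definition lp_zero_opt ::
  "nat \<Rightarrow> nat \<Rightarrow> nat \<Rightarrow> nat \<Rightarrow> nat \<Rightarrow> (nat \<Rightarrow> (nat \<Rightarrow> nat) \<Rightarrow> (nat \<Rightarrow> nat))
   \<Rightarrow> (nat \<Rightarrow> nat \<Rightarrow> nat) \<Rightarrow> (nat \<Rightarrow> nat)
   \<Rightarrow> (nat \<Rightarrow> nat \<Rightarrow> real) \<Rightarrow> (nat \<Rightarrow> (nat \<Rightarrow> nat) \<Rightarrow> real) \<Rightarrow> bool" where
  "lp_zero_opt q n k m u f I xs bv bf \<longleftrightarrow>
     (\<forall>i<n. (\<forall>x<q. bv i x \<ge> 0) \<and> (\<Sum>x<q. bv i x) = 1) \<and>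
     (\<forall>a<m. (\<forall>X\<in>qcube q {..<k}. bf a X \<ge> 0) \<and> (\<Sum>X\<in>qcube q {..<k}. bf a X) = 1) \<and>
     (\<forall>a<m. \<forall>s<k. \<forall>x<q. (\<Sum>X\<in>{X\<in>qcube q {..<k}. X s = x}. bf a X) = bv (I a s) x) \<and>
     (\<forall>i<u. bv i (xs i) = 1) \<and>
     (\<Sum>a<m. \<Sum>X\<in>qcube q {..<k}.
        bf a X * (if f a X \<noteq> f a (\<lambda>s\<in>{..<k}. xs (I a s)) then 1 else 0)) = 0"

definition integral_part :: "nat \<Rightarrow> nat \<Rightarrow> (nat \<Rightarrow> nat \<Rightarrow> real) \<Rightarrow> nat set" where
  "integral_part q n bv = {i\<in>{..<n}. \<exists>x<q. bv i x = 1}"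

end

theory Submission
  imports Defs "HOL-Real_Asymp.Real_Asymp"
begin

text \<open>Call a set \<open>S\<close> of variables closed if every constraint with at least \<open>r - 1\<close> of its variables in \<open>S\<close>
  has all of them in \<open>S\<close>. Giving planted values to a closed set containing the \<open>u\<close> known variables and
  uniform marginals to all others extends to a zero-optimal point, because a constraint not inside
  \<open>S\<close> meets \<open>S\<close> in at most \<open>r - 2\<close> positions. A closed set is found by exploring the variables one at a time,
  activating a constraint once \<open>r - 1\<close> of its variables have been explored. If this does not stop within
  \<open>T\<close> steps, where \<open>T\<close> is just below \<open>\<sigma> u\<close> with \<open>\<sigma> = (r - 1) / (r - 2)\<close>, then at least
  \<open>u / ((r - 2) (k - r + 1))\<close> constraints are active at time \<open>T\<close>. The number of active constraints has
  factorial moments at most those of independent constraints with success probability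
  about \<open>(k choose (r - 1)) (T / n) ^ (r - 1)\<close>: replacing the activating entries of a constraint by
  their exploration times is injective. The critical value is where the resulting mean reaches the
  required number; it is sharp for this argument since \<open>\<sigma>\<close> maximises \<open>(\<sigma> - 1) / \<sigma> ^ (r - 1)\<close>.\<close>

section \<open>Zero-optimal points from closed sets\<close>

lemma finite_qcube [simp]: "finite S \<Longrightarrow> finite (qcube q S)"
  by (simp add: qcube_def finite_PiE)

lemma card_qcube: "finite S \<Longrightarrow> card (qcube q S) = q ^ card S"
  by (simp add: qcube_def card_PiE)

text \<open>Comparing point masses at \<open>(z, y)\<close> turns uniformity into a count of fibres,
  multiplied out so that it is an identity between natural numbers.\<close>

lemma wise_indep_fibre_card:
  assumes wi: "wise_indep q k l r f" and q: "q > 0"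
    and T: "T \<subseteq> {..<k}" "card T \<le> r - 1"
    and z: "z \<in> qcube q T" and y: "y \<in> qcube q {..<l}"
  shows "card {X \<in> qcube q {..<k}. restrict X T = z \<and> f X = y} * q ^ (card T + l) = q ^ k"
proof -
  let ?Q = "qcube q {..<k}" and ?F = "{X \<in> qcube q {..<k}. restrict X T = z \<and> f X = y}"
  let ?R = "qcube q T \<times> qcube q {..<l}"
  have finT: "finite T" using T(1) finite_subset by blast
  have cQ: "card ?Q = q ^ k" by (simp add: card_qcube)
  have cR: "card ?R = q ^ (card T + l)"
    using finT by (simp add: card_cartesian_product card_qcube power_add)
  have neQ: "?Q \<noteq> {}" using cQ q by fastforce
  have neR: "?R \<noteq> {}" using z y by blast
  have "pmf (map_pmf (\<lambda>X. (restrict X T, f X)) (pmf_of_set ?Q)) (z, y) = card ?F / card ?Q"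
    using neQ by (simp add: pmf_map measure_pmf_of_set vimage_def Int_def)
  moreover have "pmf (pmf_of_set ?R) (z, y) = 1 / card ?R"
    using neR z y finT by (subst pmf_of_set) auto
  ultimately have "card ?F / card ?Q = 1 / card ?R"
    using wi T by (simp add: wise_indep_def)
  hence "real (card ?F) * card ?R = card ?Q"
    using q by (simp add: cQ cR field_simps)
  hence "real (card ?F * card ?R) = real (card ?Q)" by simp
  thus ?thesis by (simp only: of_nat_eq_iff cQ cR)
qed

text \<open>One further position added to \<open>T\<close> still makes at most \<open>r - 1\<close> of them, so that position
  stays uniform under conditioning on the positions in \<open>T\<close> and on the output.\<close>
lemma lp_local_distribution:
  assumes wi: "wise_indep q k l r f" and q: "q > 0" and T: "T \<subseteq> {..<k}" "card T + 2 \<le> r"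
    and x: "x \<in> qcube q {..<k}" and y: "f x \<in> qcube q {..<l}"
  shows "\<exists>b :: (nat \<Rightarrow> nat) \<Rightarrow> real. (\<forall>X. b X \<ge> 0) \<and> (\<Sum>X\<in>qcube q {..<k}. b X) = 1 \<and>
    (\<forall>X. f X \<noteq> f x \<longrightarrow> b X = 0) \<and>
    (\<forall>s<k. \<forall>z<q. (\<Sum>X\<in>{X \<in> qcube q {..<k}. X s = z}. b X)
      = (if s \<in> T then if z = x s then 1 else 0 else 1 / real q))"
proof -
  let ?Q = "qcube q {..<k}"
  have finT: "finite T" using T(1) finite_subset by blast
  \<comment> \<open>\<open>b\<close> is the uniform distribution conditioned on the values of
    \<open>x\<close> at the positions in \<open>T\<close> and on the output \<open>f x\<close>. The
    point \<open>x\<close> itself shows that \<open>F\<close> is nonempty.\<close>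
  define F where "F = {X \<in> ?Q. restrict X T = restrict x T \<and> f X = f x}"
  define b where "b X = (if X \<in> F then 1 / real (card F) else 0)" for X
  have FQ: "F \<subseteq> ?Q" by (auto simp: F_def)
  have finF: "finite F" using FQ finite_subset[OF _ finite_qcube] by blast
  have xT: "restrict x T \<in> qcube q T" using x T by (auto simp: qcube_def)
  have cF: "card F * q ^ (card T + l) = q ^ k"
    unfolding F_def using wise_indep_fibre_card[OF wi q T(1) _ xT y] T(2) by simp
  have F0: "card F > 0" using x finF by (auto simp: F_def card_gt_0_iff)
  have sum_b: "(\<Sum>X\<in>{X \<in> ?Q. P X}. b X) = card {X \<in> F. P X} / card F" for P
  proof -
    have "(\<Sum>X\<in>{X \<in> ?Q. P X}. b X) = (\<Sum>X\<in>{X \<in> F. P X}. 1 / real (card F))"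
      by (rule sum.mono_neutral_cong_right) (use FQ in \<open>auto simp: b_def\<close>)
    thus ?thesis by simp
  qed
  show ?thesis
  proof (intro exI[of _ b] conjI allI impI)
    show "b X \<ge> 0" for X by (simp add: b_def)
    show "(\<Sum>X\<in>?Q. b X) = 1" using sum_b[of "\<lambda>_. True"] F0 by simp
    show "b X = 0" if "f X \<noteq> f x" for X using that by (auto simp: b_def F_def)
    fix s z assume sz: "s < k" "z < q"
    have "(\<Sum>X\<in>{X \<in> ?Q. X s = z}. b X) = (if z = x s then 1 else 0)" if s: "s \<in> T"
    proof -
      have "X s = x s" if "X \<in> F" for X
        using that s by (auto simp: F_def restrict_def fun_eq_iff split: if_splits)
      hence "{X \<in> F. X s = z} = (if z = x s then F else {})" by auto
      thus ?thesis using F0 by (simp add: sum_b)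
    qed
    moreover have "(\<Sum>X\<in>{X \<in> ?Q. X s = z}. b X) = 1 / real q" if s: "s \<notin> T"
    proof -
      let ?z = "(restrict x T)(s := z)"
      have zT: "?z \<in> qcube q (insert s T)"
        using xT sz unfolding qcube_def by (simp add: PiE_fun_upd)
      have "restrict X (insert s T) = ?z \<longleftrightarrow> restrict X T = restrict x T \<and> X s = z" for X
        using s by (auto simp: restrict_def fun_eq_iff)
      hence "{X \<in> F. X s = z} = {X \<in> ?Q. restrict X (insert s T) = ?z \<and> f X = f x}"
        by (auto simp: F_def)
      hence "card {X \<in> F. X s = z} * q ^ (card (insert s T) + l) = q ^ k"
        using wise_indep_fibre_card[OF wi q _ _ zT y] T s sz finT by simp
      hence "card {X \<in> F. X s = z} * q * q ^ (card T + l) = card F * q ^ (card T + l)"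
        using cF s finT by (simp add: mult_ac)
      hence "card {X \<in> F. X s = z} * q = card F" using q by simp
      hence "real (card {X \<in> F. X s = z}) * q = card F" by (simp flip: of_nat_mult)
      thus ?thesis using F0 q by (simp add: sum_b field_simps)
    qed
    ultimately show "(\<Sum>X\<in>{X \<in> ?Q. X s = z}. b X)
      = (if s \<in> T then if z = x s then 1 else 0 else 1 / real q)" by simp
  qed
qed

text \<open>The variable marginals \<open>bv\<close> are fixed first, so consistency between
  constraints is automatic and each constraint can be treated alone: a point mass if it lies inside
  \<open>S\<close>, \<open>lp_local_distribution\<close> otherwise. Since \<open>q \<ge> 2\<close>,
  the marginals \<open>1 / q\<close> are not integral, so the integral part is exactly
  \<open>S\<close>.\<close>

lemma lp_zero_opt_of_closed:
  assumes q: "q \<ge> 2" and r: "r \<ge> 2"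
    and I: "I \<in> {..<m} \<rightarrow>\<^sub>E tuples n k" and xs: "xs \<in> qcube q {..<n}"
    and f: "\<And>a. a < m \<Longrightarrow> surj_local q k l (f a) \<and> wise_indep q k l r (f a)"
    and S: "S \<subseteq> {..<n}" "{..<u} \<subseteq> S"
    and closed: "\<And>a. a < m \<Longrightarrow> r - 1 \<le> card {s. s < k \<and> I a s \<in> S} \<Longrightarrow> I a ` {..<k} \<subseteq> S"
  shows "\<exists>bv bf. lp_zero_opt q n k m u f I xs bv bf \<and> integral_part q n bv = S"
proof -
  let ?Q = "qcube q {..<k}"
  define x where "x a = (\<lambda>s\<in>{..<k}. xs (I a s))" for a
  define bv :: "nat \<Rightarrow> nat \<Rightarrow> real" where
    "bv i z = (if i \<in> S then if z = xs i then 1 else 0 else 1 / real q)" for i z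
  have Iran: "I a s < n" if "a < m" "s < k" for a s
    using I that by (auto simp: tuples_def PiE_iff)
  have xsq: "xs i < q" if "i < n" for i using xs that by (auto simp: qcube_def)
  have x: "x a \<in> ?Q" if "a < m" for a
    using that Iran xsq by (auto simp: x_def qcube_def)
  \<comment> \<open>All that the LP and objective value zero demand of a single
    \<open>b_(a)\<close>.\<close>
  define good where "good a b \<longleftrightarrow> (\<forall>X\<in>?Q. b X \<ge> 0) \<and> (\<Sum>X\<in>?Q. b X) = 1 \<and>
      (\<forall>s<k. \<forall>z<q. (\<Sum>X\<in>{X \<in> ?Q. X s = z}. b X) = bv (I a s) z) \<and>
      (\<forall>X. f a X \<noteq> f a (x a) \<longrightarrow> b X = 0)" for a and b :: "(nat \<Rightarrow> nat) \<Rightarrow> real"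
  have "\<exists>b. good a b" if a: "a < m" for a
  proof (cases "I a ` {..<k} \<subseteq> S")
    case True
    let ?b = "\<lambda>X. if X = x a then 1 else (0::real)"
    have "(\<Sum>X\<in>{X \<in> ?Q. X s = z}. ?b X) = bv (I a s) z" if "s < k" "z < q" for s z
    proof -
      have "I a s \<in> S" "x a s = xs (I a s)" using True that by (auto simp: x_def)
      thus ?thesis using x[OF a] by (auto simp: bv_def)
    qed
    hence "good a ?b" using x[OF a] by (auto simp: good_def)
    thus ?thesis by blast
  next
    case False
    let ?T = "{s. s < k \<and> I a s \<in> S}"
    have T: "?T \<subseteq> {..<k}" by auto
    \<comment> \<open>By closedness, a constraint not inside \<open>S\<close> has at most
      \<open>r - 2\<close> positions in \<open>S\<close>.\<close>
    have cT: "card ?T + 2 \<le> r" using closed[OF a] False r by linarith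
    have y: "f a (x a) \<in> qcube q {..<l}" using f[OF a] x[OF a] by (auto simp: surj_local_def)
    have wi: "wise_indep q k l r (f a)" and q0: "q > 0" using f[OF a] q by auto
    obtain b :: "(nat \<Rightarrow> nat) \<Rightarrow> real" where
      b: "\<forall>X. b X \<ge> 0" "(\<Sum>X\<in>?Q. b X) = 1" "\<forall>X. f a X \<noteq> f a (x a) \<longrightarrow> b X = 0"
      and marginal: "\<forall>s<k. \<forall>z<q. (\<Sum>X\<in>{X \<in> ?Q. X s = z}. b X)
        = (if s \<in> ?T then if z = x a s then 1 else 0 else 1 / real q)"
      using lp_local_distribution[of q k l r "f a" ?T "x a", OF wi q0 T cT x[OF a] y]
      by (elim exE conjE)
    have "(\<Sum>X\<in>{X \<in> ?Q. X s = z}. b X) = bv (I a s) z" if s: "s < k" and z: "z < q" for s z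
    proof -
      note marginal[rule_format, OF s z]
      also have "(if s \<in> ?T then if z = x a s then 1 else 0 else 1 / real q) = bv (I a s) z"
        using s by (simp add: bv_def x_def)
      finally show ?thesis .
    qed
    hence "good a b" unfolding good_def using b by (intro conjI ballI allI impI) blast+
    thus ?thesis by blast
  qed
  then obtain bf where "\<And>a. a < m \<Longrightarrow> good a (bf a)" by metis
  note bf = this[unfolded good_def]
  have "lp_zero_opt q n k m u f I xs bv bf"
    unfolding lp_zero_opt_def
  proof (intro conjI allI impI)
    show "(\<Sum>z<q. bv i z) = 1" if "i < n" for i
      using xsq[OF that] q by (cases "i \<in> S") (simp_all add: bv_def)
    show "(\<Sum>a<m. \<Sum>X\<in>?Q. bf a X * (if f a X \<noteq> f a (\<lambda>s\<in>{..<k}. xs (I a s)) then 1 else 0)) = 0"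
      by (intro sum.neutral ballI) (use bf in \<open>auto simp: x_def\<close>)
  qed (use bf S in \<open>auto simp: bv_def\<close>)
  moreover have "integral_part q n bv = S"
    using S(1) xsq q by (auto simp: integral_part_def bv_def)
  ultimately show ?thesis by blast
qed

section \<open>The exploration process\<close>

lemma finite_tuples [simp]: "finite (tuples n k)"
  by (rule finite_subset[of _ "{..<k} \<rightarrow>\<^sub>E {..<n}"]) (auto simp: tuples_def intro: finite_PiE)

text \<open>A crude bound suffices: \<open>k\<close> is fixed, so \<open>(n / (n - k)) ^ k\<close>
  tends to 1.\<close>

lemma card_tuples_ge: "(n - k) ^ k \<le> card (tuples n k)"
proof -
  have "card (tuples n k) = (\<Prod>i<k. n - i)"
    using card_inj_on_subset_funcset[of "{..<k}" "{..<n}" "{..<k}"]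
    by (simp add: tuples_def atLeast0LessThan)
  moreover have "(\<Prod>i<k. n - k) \<le> (\<Prod>i<k. n - i)" by (rule prod_mono) auto
  ultimately show ?thesis by simp
qed

text \<open>The generator \<open>I\<close> stays an argument, because the counting compares the
  explorations of different generators.\<close>

locale exploration =
  fixes m k r u :: nat
  assumes r_ge_2: "2 \<le> r"
begin

definition active :: "(nat \<Rightarrow> nat \<Rightarrow> nat) \<Rightarrow> nat set \<Rightarrow> nat set" where
  "active I P = {a. a < m \<and> r - 1 \<le> card {s. s < k \<and> I a s \<in> P}}"

definition disc :: "(nat \<Rightarrow> nat \<Rightarrow> nat) \<Rightarrow> nat set \<Rightarrow> nat set" where
  "disc I P = {..<u} \<union> (\<Union>a\<in>active I P. I a ` {..<k})"

text \<open>The default value when nothing is left to explore is irrelevant; it only has to be new.\<close>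
definition next_var :: "(nat \<Rightarrow> nat \<Rightarrow> nat) \<Rightarrow> nat set \<Rightarrow> nat" where
  "next_var I P = (if disc I P \<subseteq> P then LEAST i. i \<notin> P else LEAST i. i \<in> disc I P - P)"

primrec explored :: "(nat \<Rightarrow> nat \<Rightarrow> nat) \<Rightarrow> nat \<Rightarrow> nat set" where
  "explored I 0 = {}"
| "explored I (Suc t) = insert (next_var I (explored I t)) (explored I t)"

definition var_at :: "(nat \<Rightarrow> nat \<Rightarrow> nat) \<Rightarrow> nat \<Rightarrow> nat" where
  "var_at I t = next_var I (explored I t)"

definition hits :: "(nat \<Rightarrow> nat \<Rightarrow> nat) \<Rightarrow> nat \<Rightarrow> nat \<Rightarrow> nat set" where
  "hits I a t = {s. s < k \<and> I a s \<in> explored I t}"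

lemma finite_hits [simp]: "finite (hits I a t)"
  by (simp add: hits_def)

lemma finite_active [simp]: "finite (active I P)"
  by (simp add: active_def)

lemma finite_disc [simp]: "finite (disc I P)"
  by (simp add: disc_def)

lemma finite_explored [simp]: "finite (explored I t)"
  by (induction t) auto

lemma explored_eq_image: "explored I t = var_at I ` {..<t}"
  by (induction t) (auto simp: var_at_def lessThan_Suc)

lemma explored_mono: "t \<le> t' \<Longrightarrow> explored I t \<subseteq> explored I t'"
  by (auto simp: explored_eq_image)

lemma hits_mono: "t \<le> t' \<Longrightarrow> hits I a t \<subseteq> hits I a t'"
  using explored_mono[of t t' I] by (auto simp: hits_def)

lemma active_explored: "active I (explored I t) = {a. a < m \<and> r - 1 \<le> card (hits I a t)}"
  by (simp add: active_def hits_def)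

lemma active_mono: "P \<subseteq> P' \<Longrightarrow> active I P \<subseteq> active I P'"
proof -
  assume "P \<subseteq> P'"
  hence "card {s. s < k \<and> I a s \<in> P} \<le> card {s. s < k \<and> I a s \<in> P'}" for a
    by (intro card_mono) auto
  thus ?thesis unfolding active_def using le_trans by blast
qed

lemma disc_mono: "P \<subseteq> P' \<Longrightarrow> disc I P \<subseteq> disc I P'"
  unfolding disc_def by (intro Un_mono subset_refl UN_mono active_mono)

lemma next_var_notin: "finite P \<Longrightarrow> next_var I P \<notin> P"
proof -
  assume P: "finite P"
  have "(LEAST i. i \<notin> P) \<notin> P" using ex_new_if_finite[OF _ P] by (metis LeastI infinite_UNIV_nat)
  moreover have "(LEAST i. i \<in> disc I P - P) \<in> disc I P - P" if "\<not> disc I P \<subseteq> P"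
    by (rule LeastI_ex) (use that in blast)
  ultimately show ?thesis by (simp add: next_var_def)
qed

lemma next_var_in_disc: "\<not> disc I P \<subseteq> P \<Longrightarrow> next_var I P \<in> disc I P"
proof -
  assume *: "\<not> disc I P \<subseteq> P"
  have "(LEAST i. i \<in> disc I P - P) \<in> disc I P - P"
    by (rule LeastI_ex) (use * in blast)
  thus ?thesis using * by (simp add: next_var_def)
qed

lemma card_explored [simp]: "card (explored I t) = t"
  by (induction t) (auto simp: next_var_notin)

text \<open>Every step picks a new variable, even after the process has stopped. Hence
  \<open>inv (var_at I)\<close> recovers the exploration time of an explored variable.\<close>

lemma inj_var_at: "inj (var_at I)"
proof -
  have "var_at I s \<noteq> var_at I t" if "s < t" for s t
  proof -
    have "var_at I s \<in> explored I t" using that by (auto simp: explored_eq_image)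
    moreover have "var_at I t \<notin> explored I t" by (simp add: var_at_def next_var_notin)
    ultimately show ?thesis by metis
  qed
  thus ?thesis by (metis injI linorder_neqE_nat)
qed

text \<open>One variable is explored per step and the entries of a tuple are distinct, so the number
  of hits grows by at most one and cannot jump over \<open>r - 1\<close>. The hit positions at that
  moment serve below as the activating pattern \<open>R a\<close>.\<close>

lemma hits_exact:
  assumes inj: "inj_on (I a) {..<k}" and T: "r - 1 \<le> card (hits I a T)"
  obtains t where "t \<le> T" "card (hits I a t) = r - 1"
proof -
  define t where "t = (LEAST t. r - 1 \<le> card (hits I a t))"
  have t: "r - 1 \<le> card (hits I a t)" unfolding t_def by (rule LeastI) (rule T)
  have tT: "t \<le> T" unfolding t_def by (rule Least_le) (rule T)
  have "hits I a 0 = {}" by (simp add: hits_def)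
  hence "t \<noteq> 0" using t r_ge_2 by (intro notI) simp
  then obtain t' where t': "t = Suc t'" by (cases t) auto
  have "card (hits I a t') < r - 1"
    using not_less_Least[of t' "\<lambda>t. r - 1 \<le> card (hits I a t)"] t' by (simp add: t_def)
  moreover have "card (hits I a t) \<le> card (hits I a t') + 1"
  proof -
    let ?N = "{s. s < k \<and> I a s = next_var I (explored I t')}"
    have "card ?N \<le> 1"
      unfolding One_nat_def
      by (subst card_le_Suc0_iff_eq) (use inj in \<open>auto simp: inj_on_def\<close>)
    moreover have "hits I a t \<subseteq> hits I a t' \<union> ?N" by (auto simp: hits_def t')
    hence "card (hits I a t) \<le> card (hits I a t' \<union> ?N)" by (intro card_mono) auto
    ultimately show ?thesis using card_Un_le[of "hits I a t'" ?N] by linarith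
  qed
  ultimately show ?thesis using t tT that by force
qed

text \<open>As long as the process has not stopped, the default branch of \<open>next_var\<close> is
  never taken.\<close>

lemma explored_subset_disc:
  assumes "\<And>t'. t' < t \<Longrightarrow> \<not> disc I (explored I t') \<subseteq> explored I t'"
  shows "explored I t \<subseteq> disc I (explored I t)"
  using assms
proof (induction t)
  case (Suc t)
  have "explored I (Suc t) \<subseteq> disc I (explored I t)"
    using Suc next_var_in_disc[of I "explored I t"] by auto
  also have "\<dots> \<subseteq> disc I (explored I (Suc t))" by (rule disc_mono) auto
  finally show ?case .
qed simp

text \<open>When a constraint becomes active, \<open>r - 1\<close> of its variables were discovered earlier.\<close>
lemma card_disc_le:
  assumes inj: "\<And>a. a < m \<Longrightarrow> inj_on (I a) {..<k}"
    and ns: "\<And>t'. t' < t \<Longrightarrow> \<not> disc I (explored I t') \<subseteq> explored I t'"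
  shows "card (disc I (explored I t)) \<le> u + (k - (r - 1)) * card (active I (explored I t))"
  using ns
proof (induction t)
  case 0
  have "active I {} = {}" using r_ge_2 by (auto simp: active_def)
  thus ?case by (simp add: disc_def)
next
  case (Suc t)
  let ?P = "explored I t" and ?P' = "explored I (Suc t)"
  let ?N = "active I ?P' - active I ?P"
  \<comment> \<open>Whatever is explored by time \<open>Suc t\<close> was discovered by time
    \<open>t\<close>, so a newly active constraint is charged only for its variables outside
    \<open>?P'\<close>.\<close>
  have sub: "?P' \<subseteq> disc I ?P"
    using Suc.prems explored_subset_disc[of t I] next_var_in_disc[of I ?P] by auto
  have act: "active I ?P \<subseteq> active I ?P'" by (rule active_mono) auto
  have new: "card (I a ` {..<k} - ?P') \<le> k - (r - 1)" if "a \<in> ?N" for a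
  proof -
    have a: "a < m" "r - 1 \<le> card {s. s < k \<and> I a s \<in> ?P'}" using that by (auto simp: active_def)
    have eq: "I a ` {..<k} - ?P' = I a ` ({..<k} - {s. s < k \<and> I a s \<in> ?P'})" by auto
    have "card (I a ` {..<k} - ?P') \<le> card ({..<k} - {s. s < k \<and> I a s \<in> ?P'})"
      unfolding eq by (rule card_image_le) simp
    also have "\<dots> = k - card {s. s < k \<and> I a s \<in> ?P'}" by (subst card_Diff_subset) auto
    finally show ?thesis using a(2) by linarith
  qed
  have "disc I ?P' \<subseteq> disc I ?P \<union> (\<Union>a\<in>?N. I a ` {..<k} - ?P')"
    using sub act unfolding disc_def by blast
  hence "card (disc I ?P') \<le> card (disc I ?P \<union> (\<Union>a\<in>?N. I a ` {..<k} - ?P'))"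
    by (intro card_mono) auto
  also have "\<dots> \<le> card (disc I ?P) + card (\<Union>a\<in>?N. I a ` {..<k} - ?P')" by (rule card_Un_le)
  also have "card (\<Union>a\<in>?N. I a ` {..<k} - ?P') \<le> (\<Sum>a\<in>?N. card (I a ` {..<k} - ?P'))"
    by (rule card_UN_le) simp
  also have "\<dots> \<le> card ?N * (k - (r - 1))"
    using sum_bounded_above[of ?N "\<lambda>a. card (I a ` {..<k} - ?P')" "k - (r - 1)"] new by simp
  also have "card (disc I ?P) \<le> u + (k - (r - 1)) * card (active I ?P)" using Suc by simp
  also have "u + (k - (r - 1)) * card (active I ?P) + card ?N * (k - (r - 1))
      = u + (k - (r - 1)) * card (active I ?P')"
  proof -
    have "card (active I ?P') = card (active I ?P) + card ?N"
      using card_Diff_subset[of "active I ?P" "active I ?P'"] card_mono[OF _ act] act by simp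
    thus ?thesis by (simp add: algebra_simps)
  qed
  finally show ?case by linarith
qed

text \<open>If the process has not stopped by time \<open>T\<close>, more than \<open>T\<close>
  variables are discovered, which \<open>card_disc_le\<close> forbids when few constraints are
  active. Where it stops, the explored set equals the discovered set and is therefore
  closed.\<close>

lemma closed_or_many_active:
  assumes I: "I \<in> {..<m} \<rightarrow>\<^sub>E tuples n k" and u: "u \<le> n"
    and small: "card (active I (explored I T)) * (k - (r - 1)) + u \<le> T"
  obtains S where "S \<subseteq> {..<n}" "{..<u} \<subseteq> S" "card S \<le> T"
    "\<And>a. a < m \<Longrightarrow> r - 1 \<le> card {s. s < k \<and> I a s \<in> S} \<Longrightarrow> I a ` {..<k} \<subseteq> S"
proof -
  have inj: "inj_on (I a) {..<k}" and ran: "I a ` {..<k} \<subseteq> {..<n}" if "a < m" for a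
    using I that by (auto simp: tuples_def PiE_iff)
  define stop where "stop t \<longleftrightarrow> disc I (explored I t) \<subseteq> explored I t" for t
  have "\<exists>t\<le>T. stop t"
  proof (rule ccontr)
    assume *: "\<not> (\<exists>t\<le>T. stop t)"
    have "card (explored I T) < card (disc I (explored I T))"
      by (rule psubset_card_mono) (use explored_subset_disc[of T I] * in \<open>auto simp: stop_def\<close>)
    moreover have "card (disc I (explored I T)) \<le> u + (k - (r - 1)) * card (active I (explored I T))"
      by (rule card_disc_le) (use inj * in \<open>auto simp: stop_def\<close>)
    ultimately show False using small by (simp add: mult.commute)
  qed
  \<comment> \<open>The first stopping time, so that no default variable has entered the explored
    set.\<close>
  define t where "t = (LEAST t. stop t)"
  have t: "stop t" "t \<le> T" "\<And>t'. t' < t \<Longrightarrow> \<not> stop t'"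
    using \<open>\<exists>t\<le>T. stop t\<close> unfolding t_def
    by (auto intro: LeastI Least_le[THEN order_trans] dest: not_less_Least)
  let ?S = "explored I t"
  have eq: "disc I ?S = ?S"
    using t explored_subset_disc[of t I] by (auto simp: stop_def)
  show ?thesis
  proof (rule that[of ?S])
    have "disc I ?S \<subseteq> {..<n}" using u ran by (fastforce simp: disc_def active_def)
    thus "?S \<subseteq> {..<n}" by (simp add: eq)
    have "{..<u} \<subseteq> disc I ?S" by (simp add: disc_def)
    thus "{..<u} \<subseteq> ?S" by (simp add: eq)
    show "card ?S \<le> T" using t by simp
    fix a assume "a < m" "r - 1 \<le> card {s. s < k \<and> I a s \<in> ?S}"
    hence "I a ` {..<k} \<subseteq> disc I ?S" by (auto simp: disc_def active_def)
    thus "I a ` {..<k} \<subseteq> ?S" by (simp add: eq)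
  qed
qed

section \<open>Counting generators with a prescribed set of active constraints\<close>

definition encode where
  "encode A R I = (\<lambda>a\<in>{..<m}. if a \<in> A then
     (\<lambda>s\<in>{..<k}. if s \<in> R a then inv (var_at I) (I a s) else I a s) else I a)"

text \<open>The pattern \<open>R\<close> is fixed in advance, so that \<open>encode\<close> need not
  record which entries it replaced; a union bound over \<open>R\<close> pays for this later.\<close>

definition triggered where
  "triggered n T A R = {I \<in> {..<m} \<rightarrow>\<^sub>E tuples n k.
     \<forall>a\<in>A. \<exists>t\<le>T. hits I a t = R a \<and> card (R a) = r - 1}"

text \<open>The exploration reads a constraint \<open>a \<in> A\<close> only once all of \<open>R a\<close> has been explored, so it can
  be replayed when the entries of \<open>R a\<close> are known only through their exploration times.\<close>
lemma inj_on_encode: "inj_on (encode A R) (triggered n T A R)"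
proof (rule inj_onI)
  fix I J assume I: "I \<in> triggered n T A R" and J: "J \<in> triggered n T A R"
    and enc: "encode A R I = encode A R J"
  have ext: "K a \<in> extensional {..<k}" if "K \<in> triggered n T A R" "a < m" for K a
    using that by (auto simp: triggered_def tuples_def PiE_iff)
  have notA: "I a = J a" if "a < m" "a \<notin> A" for a
    using fun_cong[OF enc, of a] that by (simp add: encode_def)
  \<comment> \<open>The hit sets of \<open>a\<close> form a chain in time and \<open>R a\<close> is
    a member of size \<open>r - 1\<close>, so every member at least that large contains it.\<close>
  have R_sub: "R a \<subseteq> hits K a t"
    if "K \<in> triggered n T A R" "a \<in> A" "r - 1 \<le> card (hits K a t)" for K a t
  proof -
    obtain t0 where t0: "hits K a t0 = R a" "card (R a) = r - 1"
      using \<open>K \<in> triggered n T A R\<close> \<open>a \<in> A\<close> by (auto simp: triggered_def)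
    show ?thesis
    proof (cases "t \<le> t0")
      case True
      moreover have "card (hits K a t0) \<le> card (hits K a t)" using that t0 by simp
      ultimately have "hits K a t = hits K a t0" by (intro card_seteq hits_mono finite_hits)
      thus ?thesis using t0 by simp
    next
      case False
      thus ?thesis using hits_mono[of t0 t K a] t0 by simp
    qed
  qed
  \<comment> \<open>Equal codes give equal exploration times on \<open>R a\<close>;
    \<open>R_sub\<close> puts these times below \<open>t\<close>, where both runs agree. Stated for
    arbitrary \<open>K\<close> and \<open>L\<close>, since the induction below uses it in both
    directions.\<close>
  have step: "K a = L a"
    if K: "K \<in> triggered n T A R" and L: "L \<in> triggered n T A R"
      and e: "encode A R K = encode A R L"
      and same: "\<forall>s<t. var_at K s = var_at L s"
      and a: "a < m" "a \<in> A" and h: "r - 1 \<le> card (hits K a t)" for K L a t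
  proof (rule extensionalityI[OF ext[OF K a(1)] ext[OF L a(1)]])
    fix s assume s: "s \<in> {..<k}"
    have e': "(if s \<in> R a then inv (var_at K) (K a s) else K a s)
        = (if s \<in> R a then inv (var_at L) (L a s) else L a s)"
      using fun_cong[OF fun_cong[OF e, of a], of s] a s by (simp add: encode_def)
    show "K a s = L a s"
    proof (cases "s \<in> R a")
      case True
      then obtain j where j: "j < t" "K a s = var_at K j"
        using R_sub[OF K a(2) h] by (auto simp: hits_def explored_eq_image)
      obtain t0 where "hits L a t0 = R a" using L a(2) by (auto simp: triggered_def)
      then obtain i where i: "L a s = var_at L i"
        using True by (auto simp: hits_def explored_eq_image)
      have "j = i" using e' True by (simp add: j i inv_f_f inj_var_at)
      thus ?thesis using same i j by simp
    next
      case False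
      thus ?thesis using e' by simp
    qed
  qed
  \<comment> \<open>If the runs agree before \<open>t\<close>, a constraint active at time
    \<open>t\<close> in either run has equal tuples in both. So the active constraints, the
    discovered sets and the next variables coincide.\<close>
  have var: "var_at I t = var_at J t" for t
  proof (induction t rule: less_induct)
    case (less t)
    have ex: "explored I t = explored J t" using less by (auto simp: explored_eq_image)
    have same: "\<forall>s<t. var_at I s = var_at J s" "\<forall>s<t. var_at J s = var_at I s"
      using less by simp_all
    have IJ: "I a = J a" if "a < m" "r - 1 \<le> card (hits I a t) \<or> r - 1 \<le> card (hits J a t)" for a
    proof (cases "a \<in> A")
      case True
      show ?thesis using that(2)
      proof
        assume "r - 1 \<le> card (hits I a t)"
        thus ?thesis by (rule step[OF I J enc same(1) that(1) True])
      next
        assume "r - 1 \<le> card (hits J a t)"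
        thus ?thesis by (rule step[OF J I enc[symmetric] same(2) that(1) True, symmetric])
      qed
    qed (rule notA[OF that(1)])
    have "r - 1 \<le> card (hits I a t) \<longleftrightarrow> r - 1 \<le> card (hits J a t)" if "a < m" for a
    proof -
      have "hits I a t = hits J a t" if "I a = J a" using that by (simp add: hits_def ex)
      thus ?thesis using IJ[OF that] by metis
    qed
    hence act: "active I (explored I t) = active J (explored J t)"
      unfolding active_explored by blast
    have "(\<Union>a\<in>active J (explored J t). I a ` {..<k}) = (\<Union>a\<in>active J (explored J t). J a ` {..<k})"
      by (rule SUP_cong) (use IJ in \<open>auto simp: active_explored\<close>)
    hence "disc I (explored I t) = disc J (explored J t)"
      unfolding disc_def act by simp
    thus ?case by (simp add: var_at_def next_var_def ex)
  qed
  have "I a = J a" if a: "a < m" for a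
  proof (cases "a \<in> A")
    case True
    then obtain t where "hits I a t = R a" "card (R a) = r - 1" using I by (auto simp: triggered_def)
    thus ?thesis using step[OF I J enc _ a True, of t] var by simp
  qed (rule notA[OF a])
  moreover have "I \<in> extensional {..<m}" "J \<in> extensional {..<m}"
    using I J by (auto simp: triggered_def PiE_iff)
  ultimately show "I = J" by (intro extensionalityI[of I "{..<m}"]) auto
qed

text \<open>Under \<open>encode\<close>, an entry in \<open>R a\<close> becomes a time below
  \<open>T\<close> and the other entries of \<open>a \<in> A\<close> range over at most
  \<open>n\<close> values; distinctness is dropped there. Constraints outside \<open>A\<close> keep
  their full choice of tuples.\<close>

lemma card_triggered_le:
  assumes A: "A \<subseteq> {..<m}" and R: "\<And>a. a \<in> A \<Longrightarrow> R a \<subseteq> {..<k} \<and> card (R a) = r - 1"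
  shows "card (triggered n T A R)
    \<le> (T ^ (r - 1) * n ^ (k - (r - 1))) ^ card A * card (tuples n k) ^ (m - card A)"
proof -
  let ?C = "\<lambda>a. PiE {..<k} (\<lambda>s. if s \<in> R a then {..<T} else {..<n})"
  let ?D = "PiE {..<m} (\<lambda>a. if a \<in> A then ?C a else tuples n k)"
  have finC: "finite (?C a)" for a by (intro finite_PiE) auto
  have finD: "finite ?D" using finC by (intro finite_PiE) auto
  have "encode A R ` triggered n T A R \<subseteq> ?D"
  proof clarify
    fix I assume I: "I \<in> triggered n T A R"
    have "inv (var_at I) (I a s) < T" if "a \<in> A" "s \<in> R a" for a s
    proof -
      obtain t where "t \<le> T" "hits I a t = R a" using I \<open>a \<in> A\<close> by (auto simp: triggered_def)
      hence "I a s \<in> explored I T"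
        using \<open>s \<in> R a\<close> explored_mono[of t T I] by (auto simp: hits_def)
      then obtain j where "j < T" "I a s = var_at I j" by (auto simp: explored_eq_image)
      thus ?thesis by (simp add: inv_f_f inj_var_at)
    qed
    thus "encode A R I \<in> ?D"
      using I A by (auto simp: encode_def triggered_def tuples_def PiE_iff)
  qed
  hence "card (triggered n T A R) \<le> card ?D"
    by (rule card_inj_on_le[OF inj_on_encode]) (rule finD)
  also have "\<dots> = (\<Prod>a<m. if a \<in> A then card (?C a) else card (tuples n k))"
    by (simp add: card_PiE if_distrib)
  also have "\<dots> = (\<Prod>a\<in>A. card (?C a)) * card (tuples n k) ^ card ({..<m} - A)"
    using A by (subst prod.If_cases) (auto simp: Int_absorb1 Diff_eq)
  also have "card ({..<m} - A) = m - card A"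
    using A by (subst card_Diff_subset) (auto intro: finite_subset)
  also have "(\<Prod>a\<in>A. card (?C a)) = (\<Prod>a\<in>A. T ^ (r - 1) * n ^ (k - (r - 1)))"
  proof (rule prod.cong[OF refl])
    fix a assume a: "a \<in> A"
    have "card (?C a) = (\<Prod>s<k. if s \<in> R a then T else n)"
      by (simp add: card_PiE if_distrib cong: if_cong)
    also have "\<dots> = T ^ card (R a) * n ^ card ({..<k} - R a)"
      using R[OF a] by (subst prod.If_cases) (auto simp: Int_absorb1 Diff_eq)
    also have "card ({..<k} - R a) = k - card (R a)"
      using R[OF a] by (subst card_Diff_subset) (auto intro: finite_subset)
    finally show "card (?C a) = T ^ (r - 1) * n ^ (k - (r - 1))" using R[OF a] by simp
  qed
  finally show ?thesis by simp
qed

text \<open>The binomial coefficient counts the \<open>M\<close>-sets \<open>A\<close> of active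
  constraints. After swapping the sums, \<open>hits_exact\<close> supplies a pattern
  \<open>R\<close> for each generator, and the union bound over patterns contributes
  \<open>(k choose (r - 1)) ^ M\<close>.\<close>

lemma factorial_moment_active:
  "(\<Sum>I\<in>{..<m} \<rightarrow>\<^sub>E tuples n k. card (active I (explored I T)) choose M)
    \<le> (m choose M) * ((k choose (r - 1)) * (T ^ (r - 1) * n ^ (k - (r - 1)))) ^ M
        * card (tuples n k) ^ (m - M)"
proof -
  let ?\<Omega> = "{..<m} \<rightarrow>\<^sub>E tuples n k"
  let ?As = "{A. A \<subseteq> {..<m} \<and> card A = M}"
  let ?Rs = "{R. R \<subseteq> {..<k} \<and> card R = r - 1}"
  let ?act = "\<lambda>I. active I (explored I T)"
  let ?b = "(T ^ (r - 1) * n ^ (k - (r - 1))) ^ M * card (tuples n k) ^ (m - M)"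
  have fin: "finite ?\<Omega>" by (intro finite_PiE) auto
  have finAs: "finite ?As" by (rule finite_subset[of _ "Pow {..<m}"]) auto
  have finRs: "finite ?Rs" by (rule finite_subset[of _ "Pow {..<k}"]) auto
  have *: "card {I \<in> ?\<Omega>. A \<subseteq> ?act I} \<le> (k choose (r - 1)) ^ M * ?b" if A: "A \<in> ?As" for A
  proof -
    have finA: "finite A" using A finite_subset[of A "{..<m}"] by auto
    have "\<exists>R\<in>A \<rightarrow>\<^sub>E ?Rs. I \<in> triggered n T A R" if I: "I \<in> ?\<Omega>" "A \<subseteq> ?act I" for I
    proof -
      have "\<exists>t\<le>T. card (hits I a t) = r - 1" if "a \<in> A" for a
      proof -
        have a: "a < m" "r - 1 \<le> card (hits I a T)" using I that A by (auto simp: active_explored)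
        have "inj_on (I a) {..<k}" using I(1) a(1) by (auto simp: tuples_def PiE_iff)
        thus ?thesis using hits_exact[of I a T] a(2) by metis
      qed
      then obtain t where t: "\<And>a. a \<in> A \<Longrightarrow> t a \<le> T \<and> card (hits I a (t a)) = r - 1" by metis
      have "(\<lambda>a\<in>A. hits I a (t a)) \<in> A \<rightarrow>\<^sub>E ?Rs" using t by (auto simp: hits_def)
      moreover have "I \<in> triggered n T A (\<lambda>a\<in>A. hits I a (t a))"
        using I(1) t by (auto simp: triggered_def)
      ultimately show ?thesis by blast
    qed
    hence "{I \<in> ?\<Omega>. A \<subseteq> ?act I} \<subseteq> (\<Union>R\<in>A \<rightarrow>\<^sub>E ?Rs. triggered n T A R)"
      by (intro subsetI) simp
    moreover have finU: "finite (A \<rightarrow>\<^sub>E ?Rs)" using finA finRs by (intro finite_PiE) auto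
    moreover have "finite (triggered n T A R)" for R
      by (rule finite_subset[OF _ fin]) (auto simp: triggered_def)
    ultimately have "card {I \<in> ?\<Omega>. A \<subseteq> ?act I} \<le> card (\<Union>R\<in>A \<rightarrow>\<^sub>E ?Rs. triggered n T A R)"
      by (intro card_mono) auto
    also have "\<dots> \<le> (\<Sum>R\<in>A \<rightarrow>\<^sub>E ?Rs. card (triggered n T A R))" by (rule card_UN_le[OF finU])
    also have "\<dots> \<le> (\<Sum>R\<in>A \<rightarrow>\<^sub>E ?Rs. ?b)"
    proof (rule sum_mono)
      fix R assume "R \<in> A \<rightarrow>\<^sub>E ?Rs"
      thus "card (triggered n T A R) \<le> ?b"
        using card_triggered_le[of A R n T] A by (auto simp: PiE_iff)
    qed
    also have "\<dots> = (k choose (r - 1)) ^ M * ?b"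
      using A finA by (simp add: card_PiE n_subsets)
    finally show ?thesis .
  qed
  have "(\<Sum>I\<in>?\<Omega>. card (?act I) choose M) = (\<Sum>I\<in>?\<Omega>. \<Sum>A\<in>?As. if A \<subseteq> ?act I then 1 else 0)"
  proof (rule sum.cong[OF refl])
    fix I
    have "card (?act I) choose M = card {A. A \<subseteq> ?act I \<and> card A = M}" by (simp add: n_subsets)
    also have "{A. A \<subseteq> ?act I \<and> card A = M} = {A \<in> ?As. A \<subseteq> ?act I}" by (auto simp: active_def)
    finally show "card (?act I) choose M = (\<Sum>A\<in>?As. if A \<subseteq> ?act I then 1 else 0)"
      using finAs by (simp flip: sum.inter_filter)
  qed
  also have "\<dots> = (\<Sum>A\<in>?As. card {I \<in> ?\<Omega>. A \<subseteq> ?act I})"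
    using fin by (subst sum.swap) (simp flip: sum.inter_filter)
  also have "\<dots> \<le> (\<Sum>A\<in>?As. (k choose (r - 1)) ^ M * ?b)" by (rule sum_mono) (rule *)
  also have "\<dots> = (m choose M) * ((k choose (r - 1)) * (T ^ (r - 1) * n ^ (k - (r - 1)))) ^ M
        * card (tuples n k) ^ (m - M)"
    by (simp add: n_subsets power_mult_distrib mult_ac)
  finally show ?thesis .
qed

end

section \<open>Tail bound\<close>

text \<open>The right-hand side is the falling factorial of \<open>N\<close> of length
  \<open>M\<close>, whose factors are all at least \<open>N - M + 1 > c\<close>.\<close>

lemma power_le_fact_mult_binomial:
  fixes c :: nat
  assumes "c + M \<le> N"
  shows "c ^ M \<le> fact M * (N choose M)"
  using assms
proof (induction M)
  case (Suc M)
  have "c ^ Suc M \<le> (N - M) * (fact M * (N choose M))"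
    using Suc by (simp add: mult_le_mono)
  also have "\<dots> = fact M * ((N - M) * (N choose M))" by (rule mult.left_commute)
  also have "(N - M) * (N choose M) = Suc M * (N choose Suc M)"
    using binomial_absorb_comp[of N M] binomial_absorption[of M N] by simp
  also have "fact M * (Suc M * (N choose Suc M)) = fact (Suc M) * (N choose Suc M)"
    by (simp only: fact_Suc of_nat_id mult_ac)
  finally show ?case .
qed simp

context exploration
begin

text \<open>Markov's inequality for the factorial moment of order \<open>M\<close>. The plain first moment
  (order \<open>X\<close>) would lose a factor of about \<open>exp X\<close>; taking \<open>M\<close> to be a small fraction of
  \<open>X\<close> makes the loss negligible.\<close>
lemma card_many_active_le:
  assumes M: "M < X" and n: "tuples n k \<noteq> {}"
  shows "real (card {I \<in> {..<m} \<rightarrow>\<^sub>E tuples n k. X \<le> card (active I (explored I T))})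
    \<le> (real m * (k choose (r - 1)) * real T ^ (r - 1) * real n ^ (k - (r - 1))
         / (card (tuples n k) * real (X - M))) ^ M * card (tuples n k) ^ m"
proof -
  let ?B = "{I \<in> {..<m} \<rightarrow>\<^sub>E tuples n k. X \<le> card (active I (explored I T))}"
  let ?w = "(k choose (r - 1)) * (T ^ (r - 1) * n ^ (k - (r - 1)))"
  let ?t = "card (tuples n k)"
  have t: "?t > 0" using n by (simp add: card_gt_0_iff)
  have fin: "finite ({..<m} \<rightarrow>\<^sub>E tuples n k)" by (intro finite_PiE) auto
  have "card ?B * (X - M) ^ M = (\<Sum>I\<in>?B. (X - M) ^ M)" by simp
  also have "\<dots> \<le> (\<Sum>I\<in>?B. fact M * (card (active I (explored I T)) choose M))"
    by (intro sum_mono power_le_fact_mult_binomial) (use M in auto)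
  also have "\<dots> \<le> (\<Sum>I\<in>{..<m} \<rightarrow>\<^sub>E tuples n k. fact M * (card (active I (explored I T)) choose M))"
    by (intro sum_mono2 fin) auto
  also have "\<dots> \<le> fact M * ((m choose M) * ?w ^ M * ?t ^ (m - M))"
    unfolding sum_distrib_left[symmetric] by (intro mult_left_mono factorial_moment_active) auto
  finally have *: "card ?B * (X - M) ^ M \<le> fact M * (m choose M) * ?w ^ M * ?t ^ (m - M)"
    by (simp add: mult_ac)
  show ?thesis
  proof (cases "M \<le> m")
    case True
    have "card ?B * (X - M) ^ M \<le> m ^ M * ?w ^ M * ?t ^ (m - M)"
      using binomial_fact_pow[of m M] by (intro order_trans[OF *] mult_right_mono) (auto simp: mult_ac)
    hence "card ?B * (X - M) ^ M * ?t ^ M \<le> m ^ M * ?w ^ M * ?t ^ (m - M) * ?t ^ M"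
      by (rule mult_right_mono) simp
    also have "\<dots> = (m * ?w) ^ M * ?t ^ m"
      using True by (simp add: power_mult_distrib mult.assoc flip: power_add)
    finally have "card ?B * (?t * (X - M)) ^ M \<le> (m * ?w) ^ M * ?t ^ m"
      by (simp add: power_mult_distrib mult_ac)
    hence "real (card ?B * (?t * (X - M)) ^ M) \<le> real ((m * ?w) ^ M * ?t ^ m)" by (rule of_nat_mono)
    hence "real (card ?B) * (?t * real (X - M)) ^ M \<le> (real m * ?w) ^ M * real ?t ^ m" by simp
    moreover have "(?t * real (X - M)) ^ M > 0" using t M by simp
    ultimately have "real (card ?B) \<le> (real m * ?w) ^ M * real ?t ^ m / (?t * real (X - M)) ^ M"
      by (simp add: pos_le_divide_eq)
    also have "\<dots> = (real m * ?w / (?t * real (X - M))) ^ M * real ?t ^ m"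
      by (simp add: power_divide)
    finally show ?thesis by (simp add: mult.assoc)
  next
    case False
    \<comment> \<open>The truncated exponent \<open>m - M\<close> breaks the previous computation,
      but now \<open>m choose M = 0\<close>, so \<open>?B\<close> is empty.\<close>
    hence "card ?B * (X - M) ^ M = 0" using * by (simp add: binomial_eq_0)
    hence "card ?B = 0" using M by simp
    thus ?thesis by (simp only:) simp
  qed
qed

text \<open>Only the generator can fail: outside \<open>?B\<close> every planted input works, so the
  good event contains a product set and the factor for the input cancels.\<close>

lemma prob_small_integral_part:
  assumes q: "q \<ge> 2" and u: "u \<le> n" and M: "M < X" and n: "k < n"
    and small: "\<And>N. N < X \<Longrightarrow> N * (k - (r - 1)) + u \<le> T"
    and f: "\<And>a. a < m \<Longrightarrow> surj_local q k l (f a) \<and> wise_indep q k l r (f a)"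
  shows "1 - (real m * (k choose (r - 1)) * real T ^ (r - 1) * real n ^ (k - (r - 1))
              / (card (tuples n k) * real (X - M))) ^ M
    \<le> measure_pmf.prob (pmf_of_set (sample_space q n k m))
        {(I, xs). \<exists>bv bf. lp_zero_opt q n k m u f I xs bv bf \<and> card (integral_part q n bv) \<le> T}"
    (is "1 - ?\<epsilon> \<le> measure_pmf.prob _ ?E")
proof -
  let ?\<Omega> = "{..<m} \<rightarrow>\<^sub>E tuples n k" and ?Q = "qcube q {..<n}"
  let ?B = "{I \<in> ?\<Omega>. X \<le> card (active I (explored I T))}"
  have "(n - k) ^ k > 0" using n by simp
  hence t: "card (tuples n k) > 0" using card_tuples_ge[of n k] by linarith
  have fin\<Omega>: "finite ?\<Omega>" by (intro finite_PiE) auto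
  have c\<Omega>: "card ?\<Omega> = card (tuples n k) ^ m" by (simp add: card_PiE)
  have cQ: "card ?Q > 0" using q by (simp add: card_qcube)
  have ne: "?\<Omega> \<times> ?Q \<noteq> {}" using c\<Omega> cQ t by (auto simp: card_gt_0_iff)
  have sub: "(?\<Omega> - ?B) \<times> ?Q \<subseteq> (?\<Omega> \<times> ?Q) \<inter> ?E"
  proof
    fix p assume "p \<in> (?\<Omega> - ?B) \<times> ?Q"
    then obtain I xs where p: "p = (I, xs)" and I: "I \<in> ?\<Omega>" "I \<notin> ?B" and xs: "xs \<in> ?Q"
      by (elim SigmaE) simp
    have "card (active I (explored I T)) * (k - (r - 1)) + u \<le> T" by (rule small) (use I in auto)
    then obtain S where S: "S \<subseteq> {..<n}" "{..<u} \<subseteq> S" "card S \<le> T"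
      "\<And>a. a < m \<Longrightarrow> r - 1 \<le> card {s. s < k \<and> I a s \<in> S} \<Longrightarrow> I a ` {..<k} \<subseteq> S"
      using closed_or_many_active[OF I(1) u]
      by blast
    have "\<exists>bv bf. lp_zero_opt q n k m u f I xs bv bf \<and> integral_part q n bv = S"
      by (rule lp_zero_opt_of_closed[OF q r_ge_2 I(1) xs f S(1,2,4)])
    thus "p \<in> (?\<Omega> \<times> ?Q) \<inter> ?E" using I(1) xs S(3) by (auto simp: p)
  qed
  have "card ?\<Omega> - card ?B = card (?\<Omega> - ?B)"
    by (rule card_Diff_subset[symmetric]) (auto intro: finite_subset[OF _ fin\<Omega>])
  moreover have "card ?B \<le> card ?\<Omega>" by (rule card_mono[OF fin\<Omega>]) auto
  ultimately have "real (card (?\<Omega> - ?B)) = card ?\<Omega> - real (card ?B)" by linarith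
  also have "\<dots> \<ge> card ?\<Omega> - ?\<epsilon> * card ?\<Omega>"
    using card_many_active_le[OF M, of n T] t unfolding c\<Omega> by fastforce
  finally have "(1 - ?\<epsilon>) * card ?\<Omega> \<le> card (?\<Omega> - ?B)" by (simp add: algebra_simps)
  hence "(1 - ?\<epsilon>) * card ?\<Omega> * card ?Q \<le> card (?\<Omega> - ?B) * real (card ?Q)"
    by (rule mult_right_mono) simp
  also have "\<dots> = card ((?\<Omega> - ?B) \<times> ?Q)" by (simp add: card_cartesian_product)
  also have "\<dots> \<le> card ((?\<Omega> \<times> ?Q) \<inter> ?E)"
    by (intro of_nat_mono card_mono sub) (use fin\<Omega> in auto)
  finally have "1 - ?\<epsilon> \<le> card ((?\<Omega> \<times> ?Q) \<inter> ?E) / (card ?\<Omega> * card ?Q)"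
    using cQ t by (subst pos_le_divide_eq) (auto simp: c\<Omega> mult.assoc)
  also have "\<dots> = measure_pmf.prob (pmf_of_set (sample_space q n k m)) ?E"
    unfolding sample_space_def using ne fin\<Omega>
    by (subst measure_pmf_of_set) (auto simp: card_cartesian_product)
  finally show ?thesis .
qed

end

section \<open>Choice of constants and asymptotics\<close>

theorem theorem1:
  fixes q k l r :: nat and u :: "nat \<Rightarrow> nat" and \<mu> :: real
    and f :: "nat \<Rightarrow> nat \<Rightarrow> (nat \<Rightarrow> nat) \<Rightarrow> (nat \<Rightarrow> nat)"
  assumes "q \<ge> 2" and "k \<ge> 3" and "1 \<le> l" and "l \<le> k - 1"
    and "3 \<le> r" and "r \<le> k"
    and "filterlim (\<lambda>n. real (u n)) at_top sequentially"
    and "(\<lambda>n. real (u n) / real n) \<longlonglongrightarrow> 0"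
    and "0 < \<mu>" and "\<mu> < mu_c k r"
    and "\<And>n a. a < gen_m \<mu> r u n \<Longrightarrow> surj_local q k l (f n a) \<and> wise_indep q k l r (f n a)"
  shows "\<exists>c>0. \<forall>\<^sub>F n in sequentially.
    measure_pmf.prob (pmf_of_set (sample_space q n k (gen_m \<mu> r u n)))
      {(I, xs). \<exists>bv bf. lp_zero_opt q n k (gen_m \<mu> r u n) (u n) (f n) I xs bv bf \<and>
                 real (card (integral_part q n bv)) < (1 + 1 / (real r - 2)) * real (u n)}
    \<ge> 1 - exp (- c * real (u n))"
proof -
  \<comment> \<open>Going past \<open>\<sigma> * u n\<close> explored variables takes about
    \<open>\<alpha> * u n\<close> active constraints, and \<open>\<epsilon>\<close> is the fraction
    of these used as moment order. This \<open>\<epsilon>\<close> keeps \<open>\<tau> < 1\<close>;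
    the gap between \<open>\<tau>\<close> and \<open>\<rho>\<close> absorbs the factor
    \<open>(n / (n - k)) ^ k\<close>.\<close>
  define \<theta> where "\<theta> = \<mu> / mu_c k r"
  define \<sigma> where "\<sigma> = 1 + 1 / (real r - 2)"
  define \<kappa> where "\<kappa> = k - (r - 1)"
  define \<alpha> where "\<alpha> = 1 / ((real r - 2) * \<kappa>)"
  define \<epsilon> where "\<epsilon> = (1 - \<theta>) / 2"
  define \<tau> where "\<tau> = \<theta> / (1 - \<epsilon>)"
  define \<rho> where "\<rho> = (1 + \<tau>) / 2"
  have r2: "real r - 2 > 0" using \<open>3 \<le> r\<close> by linarith
  have \<kappa>: "\<kappa> > 0" "real \<kappa> = real k - (real r - 1)"
    using \<open>r \<le> k\<close> \<open>3 \<le> r\<close> by (auto simp: \<kappa>_def of_nat_diff)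
  have mu_c: "mu_c k r > 0" using \<open>0 < \<mu>\<close> \<open>\<mu> < mu_c k r\<close> by linarith
  have \<theta>: "0 < \<theta>" "\<theta> < 1" using \<open>0 < \<mu>\<close> \<open>\<mu> < mu_c k r\<close> mu_c by (auto simp: \<theta>_def)
  have \<epsilon>: "0 < \<epsilon>" "\<epsilon> < 1" using \<theta> by (auto simp: \<epsilon>_def)
  have \<tau>: "\<tau> < 1" "0 < \<tau>" using \<theta> \<epsilon> by (auto simp: \<epsilon>_def \<tau>_def field_simps)
  hence \<rho>: "0 < \<rho>" "\<rho> < 1" "\<tau> < \<rho>" by (auto simp: \<rho>_def)
  have \<sigma>: "\<sigma> > 1" "\<sigma> = (real r - 1) / (real r - 2)" using r2 by (auto simp: \<sigma>_def field_simps)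
  have \<alpha>: "\<alpha> > 0" "\<alpha> * \<kappa> = \<sigma> - 1" using r2 \<kappa> by (auto simp: \<alpha>_def \<sigma>_def field_simps)
  \<comment> \<open>Up to the factor \<open>u n\<close>, the left side is the approximate mean for
    independent constraints at time \<open>\<sigma> * u n\<close>, and \<open>\<alpha>\<close> is
    the required number. Their ratio is \<open>\<mu> / mu_c k r\<close>, which is where the critical
    value comes from.\<close>
  have \<theta>_eq: "\<mu> * (k choose (r - 1)) * \<sigma> ^ (r - 1) = \<theta> * \<alpha>"
  proof -
    have "real (k choose (r - 1)) * \<kappa> = r * real (k choose r)"
      using binomial_absorb_comp[of k "r - 1"] binomial_absorption[of "r - 1" k] \<open>3 \<le> r\<close>
      unfolding \<kappa>_def by (simp flip: of_nat_mult add: mult.commute)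
    hence C: "real (k choose (r - 1)) = r * real (k choose r) / \<kappa>" using \<kappa>(1) by (simp add: eq_divide_eq)
    have C0: "real (k choose r) > 0" using \<open>r \<le> k\<close> by simp
    have "r - 1 = Suc (r - 2)" using \<open>3 \<le> r\<close> by simp
    hence "(real r - 2) ^ (r - 1) = (real r - 2) ^ (r - 2) * (real r - 2)"
      by (simp only: power_Suc2)
    hence "\<sigma> ^ (r - 1) = (real r - 1) ^ (r - 1) / ((real r - 2) ^ (r - 2) * (real r - 2))"
      by (simp add: \<sigma>(2) power_divide)
    moreover have "real r - 1 > 0" using r2 by simp
    ultimately show ?thesis
      using r2 \<kappa>(1) C0 \<open>3 \<le> r\<close> unfolding C \<theta>_def \<alpha>_def mu_c_def by (simp add: field_simps)
  qed
  \<comment> \<open>\<open>\<epsilon> * \<alpha> / 2\<close> is a lower bound for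
    \<open>M / u n\<close>; the half pays for the floor in \<open>M\<close>.\<close>
  define c where "c = - ln \<rho> * (\<epsilon> * \<alpha> / 2)"
  have c: "c > 0" unfolding c_def by (intro mult_pos_pos) (use \<rho> \<epsilon> \<alpha> in auto)
  have "(\<lambda>n. \<tau> * (real n / (real n - real k)) ^ k) \<longlonglongrightarrow> \<tau> * 1 ^ k"
  proof (intro tendsto_mult tendsto_const tendsto_power)
    show "(\<lambda>n. real n / (real n - real k)) \<longlonglongrightarrow> 1" by real_asymp
  qed
  hence ev_\<rho>: "\<forall>\<^sub>F n in sequentially. \<tau> * (real n / (real n - real k)) ^ k < \<rho>"
    using \<rho>(3) by (intro order_tendstoD) auto
  have ev_un: "\<forall>\<^sub>F n in sequentially. real (u n) / real n < 1"
    using assms(8) by (rule order_tendstoD) simp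
  have ev_u: "\<forall>\<^sub>F n in sequentially. real (u n) \<ge> max 1 (2 / (\<epsilon> * \<alpha>))"
    using assms(7) unfolding filterlim_at_top by blast
  have "\<forall>\<^sub>F n in sequentially. 
    measure_pmf.prob (pmf_of_set (sample_space q n k (gen_m \<mu> r u n)))
      {(I, xs). \<exists>bv bf. lp_zero_opt q n k (gen_m \<mu> r u n) (u n) (f n) I xs bv bf \<and>
                 real (card (integral_part q n bv)) < \<sigma> * real (u n)}
    \<ge> 1 - exp (- c * real (u n))"
    using ev_\<rho> ev_un ev_u eventually_gt_at_top[of k]
  proof eventually_elim
    case (elim n)
    define m where "m = gen_m \<mu> r u n"
    \<comment> \<open>\<open>T\<close> is the largest integer strictly below
      \<open>\<sigma> * u n\<close>, so \<open>card \<le> T\<close> is exactly the strict bound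
      claimed; \<open>N < X\<close> likewise means \<open>N < \<alpha> * u n\<close>.\<close>
    define T where "T = nat \<lceil>\<sigma> * u n\<rceil> - 1"
    define X where "X = nat \<lceil>\<alpha> * u n\<rceil>"
    define M where "M = nat \<lfloor>\<epsilon> * (\<alpha> * u n)\<rfloor>"
    interpret exploration m k r "u n" by unfold_locales (use \<open>3 \<le> r\<close> in simp)
    have u1: "real (u n) \<ge> 1" and u2: "\<epsilon> * \<alpha> * u n / 2 \<ge> 1"
      using elim(3) \<epsilon> \<alpha> by (auto simp: field_simps)
    have un: "u n \<le> n" using elim(2,4) by (simp add: divide_less_eq)
    have \<sigma>u: "\<sigma> * u n \<ge> 1" using mult_mono[of 1 \<sigma> 1 "real (u n)"] \<sigma> u1 by simp
    have T_iff: "t \<le> T \<longleftrightarrow> real t < \<sigma> * u n" for t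
      using \<sigma>u unfolding T_def by linarith
    have X_iff: "t < X \<longleftrightarrow> real t < \<alpha> * u n" for t
      unfolding X_def by linarith
    have \<alpha>u: "\<alpha> * u n > 0" using \<alpha> u1 by simp
    have \<epsilon>\<alpha>u: "\<epsilon> * (\<alpha> * u n) < \<alpha> * u n" using mult_strict_right_mono[of \<epsilon> 1 "\<alpha> * u n"] \<epsilon> \<alpha>u by simp
    have M_le: "real M \<le> \<epsilon> * (\<alpha> * u n)" using \<epsilon>(1) \<alpha>u unfolding M_def by (simp add: of_nat_floor)
    have MX: "M < X" unfolding X_iff using M_le \<epsilon>\<alpha>u by linarith
    have XM: "(1 - \<epsilon>) * (\<alpha> * u n) \<le> real (X - M)"
    proof -
      have "\<alpha> * u n \<le> X" unfolding X_def by (rule real_nat_ceiling_ge)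
      thus ?thesis using MX M_le by (simp add: of_nat_diff algebra_simps)
    qed
    have small: "N * (k - (r - 1)) + u n \<le> T" if "N < X" for N
    proof -
      have "real N * \<kappa> < \<alpha> * u n * \<kappa>" using that \<kappa>(1) unfolding X_iff by simp
      also have "\<dots> = (\<alpha> * \<kappa>) * u n" by simp
      finally have "real N * \<kappa> + u n < \<sigma> * u n" unfolding \<alpha>(2) by (simp add: algebra_simps)
      thus ?thesis unfolding T_iff \<kappa>_def by simp
    qed
    let ?R = "real m * (k choose (r - 1)) * real T ^ (r - 1) * real n ^ (k - (r - 1))
              / (card (tuples n k) * real (X - M))"
    \<comment> \<open>The powers of \<open>n\<close> in the numerator combine to
      \<open>n ^ k\<close>, those of \<open>u n\<close> leave one factor that cancels against
      \<open>\<alpha> * u n\<close>, and \<open>\<tau> * (n / (n - k)) ^ k\<close> remains.\<close>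
    have R: "?R \<le> \<rho>"
    proof -
      let ?C = "real (k choose (r - 1))" and ?U = "real (u n)"
      have nk: "real n - k > 0" using elim(4) by auto
      have m_le: "real m \<le> \<mu> * real n ^ (r - 1) / ?U ^ (r - 2)"
        using \<open>0 < \<mu>\<close> unfolding m_def gen_m_def by (intro of_nat_floor) auto
      have T_le: "real T \<le> \<sigma> * ?U" using T_iff[of T] by simp
      have t_ge: "(real n - k) ^ k \<le> card (tuples n k)"
        using of_nat_mono[OF card_tuples_ge[of n k], where 'a = real] elim(4) by (simp add: of_nat_diff)
      have "?R \<le> (\<mu> * real n ^ (r - 1) / ?U ^ (r - 2)) * ?C * (\<sigma> * ?U) ^ (r - 1) * real n ^ (k - (r - 1))
              / ((real n - k) ^ k * ((1 - \<epsilon>) * (\<alpha> * ?U)))"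
        by (intro frac_le mult_mono power_mono m_le T_le t_ge XM mult_nonneg_nonneg mult_pos_pos zero_less_power)
           (use nk \<epsilon> \<alpha>(1) u1 \<sigma>(1) \<open>0 < \<mu>\<close> in auto)
      also have "\<dots> = (\<mu> * ?C * \<sigma> ^ (r - 1)) * (?U ^ (r - 1) / ?U ^ (r - 2)) * (real n ^ (r - 1) * real n ^ (k - (r - 1)))
              / ((real n - k) ^ k * ((1 - \<epsilon>) * (\<alpha> * ?U)))"
        by (simp add: power_mult_distrib mult_ac)
      also have "?U ^ (r - 1) / ?U ^ (r - 2) = ?U"
        using u1 \<open>3 \<le> r\<close> by (subst power_diff[symmetric]) (auto simp: Suc_diff_le eval_nat_numeral)
      also have "real n ^ (r - 1) * real n ^ (k - (r - 1)) = real n ^ k"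
        using \<open>r \<le> k\<close> by (subst power_add[symmetric]) auto
      also have "(\<mu> * ?C * \<sigma> ^ (r - 1)) * ?U * real n ^ k / ((real n - k) ^ k * ((1 - \<epsilon>) * (\<alpha> * ?U)))
          = \<tau> * (real n / (real n - k)) ^ k"
        unfolding \<theta>_eq \<tau>_def using \<alpha> u1 by (simp add: power_divide)
      also have "\<dots> \<le> \<rho>" using elim(1) by simp
      finally show ?thesis .
    qed
    \<comment> \<open>The floor loses at most 1, which by \<open>u2\<close> is at most half of
      \<open>\<epsilon> * \<alpha> * u n\<close>.\<close>
    have "real M \<ge> \<epsilon> * \<alpha> / 2 * u n"
      using u2 unfolding M_def by (simp add: mult.assoc) linarith
    hence "real M * ln \<rho> \<le> \<epsilon> * \<alpha> / 2 * u n * ln \<rho>" using \<rho> by (intro mult_right_mono_neg) auto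
    hence "exp (real M * ln \<rho>) \<le> exp (- c * u n)" by (simp add: c_def mult_ac)
    moreover have "?R ^ M \<le> \<rho> ^ M" using R by (rule power_mono) simp
    moreover have "\<rho> ^ M = exp (real M * ln \<rho>)" using \<rho>(1) by (simp add: exp_of_nat_mult)
    ultimately have "1 - exp (- c * u n) \<le> 1 - ?R ^ M" by linarith
    also have "1 - ?R ^ M \<le> measure_pmf.prob (pmf_of_set (sample_space q n k m))
        {(I, xs). \<exists>bv bf. lp_zero_opt q n k m (u n) (f n) I xs bv bf \<and> card (integral_part q n bv) \<le> T}"
      using prob_small_integral_part[OF \<open>q \<ge> 2\<close> un MX elim(4) small, where f = "f n" and l = l] assms(11) by (simp add: m_def)
    finally show ?case by (simp add: T_iff m_def)
  qed
  thus ?thesis using c by (auto simp: \<sigma>_def)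
qed

end
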